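(* Let $n\ge1$ and let $(h^B_{ij})_{0\le j\le i\le n}$ be the $h$-triangle of $\Delta_{\mathrm{SDyck}_{2n}}$. For $0\le j\le i\le n$, \[ h^B_{ij}=\Big|\left\{\,w\in\mathrm{SDyck}_{2n}^{\max} : |V^{\mathrm{half}}(w)|=i\text{ and }\mathrm{suc}_B(w)=i-j\,\right\}\Big| . \]
   Context: A Dyck path of semilength $m$ is a word $w=w_1\cdots w_{2m}$ in $\{U,D\}$ with equally many $U$'s and $D$'s such that every prefix contains at least as many $U$'s as $D$'s. It is symmetric if $w_{2m+1-i}=\overline{w_i}$ for all $1\le i\le 2m$, where $\overline U=D$, $\overline D=U$. $\mathrm{SDyck}_{2n}$ is the set of symmetric Dyck paths of semilength $2n$ (length $4n$). A valley of $w$ is an index $i$ with $w_i=D$, $w_{i+1}=U$, identified with its position $(i,y)$, where $y$ is the number of $U$'s minus the number of $D$'s in $w_1\cdots w_i$; $V(w)$ is the set of valley positions. For $w\in\mathrm{SDyck}_{2n}$ put $V^{\mathrm{half}}(w)=\{(x,y)\in V(w): x\le 2n\}$, and $\Delta_{\mathrm{SDyck}_{2n}}=\{V^{\mathrm{half}}(w) : w\in\mathrm{SDyck}_{2n}\}$, which is a simplicial complex (isomorphic to the complex of antichains in the root poset of type $B_n$). $\mathrm{SDyck}_{2n}^{\max}$ is the set of $w\in\mathrm{SDyck}_{2n}$ for which $V^{\mathrm{half}}(w)$ is a maximal face of $\Delta_{\mathrm{SDyck}_{2n}}$. Define $\mathrm{suc}_B(w)=\big|\{(x,y)\in V^{\mathrm{half}}(w)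 : (x-2,y)\in V^{\mathrm{half}}(w)\cup\{(0,0)\}\}\big|$. For a simplicial complex $\Delta$, the degree of a face $\sigma$ is $\deg(\sigma)=\max\{|\tau| : \tau\in\Delta,\ \sigma\subseteq\tau\}$, and $f_{ij}$ is the number of faces $\sigma$ with $|\sigma|=j$ and $\deg(\sigma)=i$. The $h$-triangle $(h_{ij})_{0\le j\le i}$ is defined by $\sum_{0\le j\le i}h_{ij}x^iy^{i-j}=\sum_{0\le j\le i}f_{ij}x^i(y-1)^{i-j}$. *)

theory Defs
  imports "HOL-Computational_Algebra.Polynomial"
begin

datatype step = U | D

primrec bar :: "step \<Rightarrow> step" where
  "bar U = D"
| "bar D = U"

definition height :: "step list \<Rightarrow> nat \<Rightarrow> int" where
  "height w i = int (count_list (take i w) U) - int (count_list (take i w) D)"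

definition dyck :: "nat \<Rightarrow> step list set" where
  "dyck m = {w. length w = 2 * m \<and> height w (2 * m) = 0 \<and> (\<forall>i\<le>2 * m. height w i \<ge> 0)}"

text \<open>Letters are numbered from 1 on paper and from 0 in lists, so the letter $w_i$ is
  \<open>w ! (i - 1)\<close>.\<close>

definition symmetric :: "step list \<Rightarrow> bool" where
  "symmetric w \<longleftrightarrow>
     (\<forall>i\<in>{1..length w}. w ! ((length w + 1 - i) - 1) = bar (w ! (i - 1)))"

definition SDyck :: "nat \<Rightarrow> step list set" where
  "SDyck m = {w \<in> dyck m. symmetric w}"

text \<open>Valley positions have integer coordinates, so that the difference \<open>x - 2\<close> in \<open>suc_B\<close>
  below is not truncated.\<close>

definition valleys :: "step list \<Rightarrow> (int \<times> int) set" where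
  "valleys w = {(int i, height w i) |i. 1 \<le> i \<and> i < length w \<and> w ! (i - 1) = D \<and> w ! i = U}"

definition V_half :: "nat \<Rightarrow> step list \<Rightarrow> (int \<times> int) set" where
  "V_half n w = {(x, y) \<in> valleys w. x \<le> 2 * int n}"

definition Delta_SDyck :: "nat \<Rightarrow> (int \<times> int) set set" where
  "Delta_SDyck n = V_half n ` SDyck (2 * n)"

definition suc_B :: "nat \<Rightarrow> step list \<Rightarrow> nat" where
  "suc_B n w = card {(x, y) \<in> V_half n w. (x - 2, y) \<in> V_half n w \<union> {(0, 0)}}"

text \<open>A complex is represented by its set of faces; the notions below are meant for finite
  complexes (containing the empty face).\<close>

definition maximal_face :: "'a set set \<Rightarrow> 'a set \<Rightarrow> bool" where
  "maximal_face \<Delta> \<sigma> \<longleftrightarrow> \<sigma> \<in> \<Delta> \<and> (\<forall>\<tau>\<in>\<Delta>. \<sigma> \<subseteq> \<tau> \<longrightarrow> \<tau> = \<sigma>)"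

definition face_degree :: "'a set set \<Rightarrow> 'a set \<Rightarrow> nat" where
  "face_degree \<Delta> \<sigma> = Max {card \<tau> |\<tau>. \<tau> \<in> \<Delta> \<and> \<sigma> \<subseteq> \<tau>}"

definition f_triangle :: "'a set set \<Rightarrow> nat \<Rightarrow> nat \<Rightarrow> nat" where
  "f_triangle \<Delta> i j = card {\<sigma> \<in> \<Delta>. card \<sigma> = j \<and> face_degree \<Delta> \<sigma> = i}"

definition max_face_size :: "'a set set \<Rightarrow> nat" where
  "max_face_size \<Delta> = Max (card ` \<Delta>)"

text \<open>Bivariate polynomials are elements of \<open>int poly poly\<close>: $x$ is the outer and $y$ the inner
  variable, and \<open>[:-1, 1:]\<close> is $y - 1$. The following is
  $\sum_{0 \le j \le i} f_{ij} x^i (y-1)^{i-j}$; all summands with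
  \<open>i > max_face_size \<Delta>\<close> vanish.\<close>

definition f_polynomial :: "'a set set \<Rightarrow> int poly poly" where
  "f_polynomial \<Delta> =
     (\<Sum>i\<le>max_face_size \<Delta>. \<Sum>j\<le>i. monom (of_nat (f_triangle \<Delta> i j) * [:-1, 1:] ^ (i - j)) i)"

text \<open>\<open>h_triangle \<Delta> i j\<close> is the coefficient of $x^i y^{i-j}$ in the above polynomial (for
  \<open>j \<le> i\<close>). The lemma \<open>h_triangle_identity\<close> is the usual defining equation, and
  \<open>h_triangle_unique\<close> states that the equation determines the numbers.\<close>

definition h_triangle :: "'a set set \<Rightarrow> nat \<Rightarrow> nat \<Rightarrow> int" where
  "h_triangle \<Delta> i j = coeff (coeff (f_polynomial \<Delta>) i) (i - j)"

lemma coeff_f_polynomial: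
  "coeff (f_polynomial \<Delta>) i =
     (if i \<le> max_face_size \<Delta>
      then \<Sum>j\<le>i. of_nat (f_triangle \<Delta> i j) * [:-1, 1:] ^ (i - j) else 0)"
proof -
  have "coeff (f_polynomial \<Delta>) i = (\<Sum>k\<le>max_face_size \<Delta>. if k = i
      then \<Sum>j\<le>i. of_nat (f_triangle \<Delta> i j) * [:-1, 1:] ^ (i - j) else 0)"
    unfolding f_polynomial_def coeff_sum coeff_monom by (intro sum.cong) auto
  then show ?thesis by simp
qed

lemma degree_coeff_f_polynomial: "degree (coeff (f_polynomial \<Delta>) i) \<le> i"
proof -
  have "degree (of_nat (f_triangle \<Delta> i j) * [:-1, 1:] ^ (i - j) :: int poly) \<le> i" for j
  proof -
    have "degree (of_nat (f_triangle \<Delta> i j) * [:-1, 1:] ^ (i - j) :: int poly)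
        \<le> degree (of_nat (f_triangle \<Delta> i j) :: int poly) + degree ([:-1, 1:] ^ (i - j) :: int poly)"
      by (rule degree_mult_le)
    also have "\<dots> \<le> 0 + 1 * (i - j)"
      using degree_power_le[of "[:-1, 1:] :: int poly" "i - j"] by simp
    finally show ?thesis by simp
  qed
  then show ?thesis
    unfolding coeff_f_polynomial by (auto intro: degree_sum_le)
qed

lemma coeff_coeff_triangle_sum:
  fixes h :: "nat \<Rightarrow> nat \<Rightarrow> int"
  shows "coeff (coeff (\<Sum>i\<le>N. \<Sum>j\<le>i. monom (monom (h i j) (i - j)) i) a) b =
     (if a \<le> N \<and> b \<le> a then h a (a - b) else 0)"
proof -
  have "coeff (coeff (\<Sum>i\<le>N. \<Sum>j\<le>i. monom (monom (h i j) (i - j)) i) a) b =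
      (\<Sum>i\<le>N. \<Sum>j\<le>i. if i = a \<and> i - j = b then h i j else 0)"
    unfolding coeff_sum coeff_monom by (intro sum.cong refl) auto
  also have "\<dots> = (\<Sum>i\<le>N. if i = a then (\<Sum>j\<le>a. if a - j = b then h a j else 0) else 0)"
    by (intro sum.cong refl) auto
  also have "\<dots> = (if a \<le> N then (\<Sum>j\<le>a. if a - j = b then h a j else 0) else 0)"
    by simp
  also have "(\<Sum>j\<le>a. if a - j = b then h a j else 0) =
      (\<Sum>j\<le>a. if j = a - b then (if b \<le> a then h a j else 0) else 0)"
    by (intro sum.cong refl) auto
  also have "\<dots> = (if b \<le> a then h a (a - b) else 0)"
    by simp
  finally show ?thesis by simp
qed

lemma h_triangle_identity:
  "(\<Sum>i\<le>max_face_size \<Delta>. \<Sum>j\<le>i. monom (monom (h_triangle \<Delta> i j) (i - j)) i) = f_polynomial \<Delta>"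
proof (intro poly_eqI)
  fix a b
  have "coeff (coeff (f_polynomial \<Delta>) a) b = 0" if "\<not> (a \<le> max_face_size \<Delta> \<and> b \<le> a)"
    using that degree_coeff_f_polynomial[of \<Delta> a]
    by (cases "a \<le> max_face_size \<Delta>") (auto simp: coeff_f_polynomial intro: coeff_eq_0)
  then show "coeff (coeff (\<Sum>i\<le>max_face_size \<Delta>. \<Sum>j\<le>i.
      monom (monom (h_triangle \<Delta> i j) (i - j)) i) a) b = coeff (coeff (f_polynomial \<Delta>) a) b"
    unfolding coeff_coeff_triangle_sum by (auto simp: h_triangle_def)
qed

lemma h_triangle_unique:
  assumes "(\<Sum>i\<le>max_face_size \<Delta>. \<Sum>j\<le>i. monom (monom (h i j) (i - j)) i) = f_polynomial \<Delta>"
    and "j \<le> i" "i \<le> max_face_size \<Delta>"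
  shows "h i j = h_triangle \<Delta> i j"
  using assms(2,3) unfolding h_triangle_def assms(1)[symmetric] coeff_coeff_triangle_sum by simp

definition SDyck_max :: "nat \<Rightarrow> step list set" where
  "SDyck_max n = {w \<in> SDyck (2 * n). maximal_face (Delta_SDyck n) (V_half n w)}"

end

theory Submission
  imports Defs
begin

text \<open>If the complex is partitioned into intervals $[F \setminus S(F), F]$, one for each maximal
  face $F$, such that all faces $\sigma$ in the interval have degree $|F|$, then the interval
  contributes $x^{|F|} \sum_{T \subseteq S(F)} (y-1)^{|T|} = x^{|F|} y^{|S(F)|}$, so $h_{ij}$ counts
  the $F$ with $|F| = i$ and $|S(F)| = i - j$. For symmetric Dyck paths $S(F)$ is the set of
  $(x,y) \in F$ with $(x-2,y) \in F \cup \{(0,0)\}$. Given $\sigma$, a face of largest size above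
  $\sigma$ whose valleys lie as far to the left as possible has the required form, because a valley
  outside $\sigma$ that is not in $S(F)$ could be moved to the left.\<close>

section \<open>Partitions of a complex into intervals\<close>

lemma sum_power_card_Pow:
  fixes a :: "'b::comm_semiring_1"
  assumes "finite A"
  shows "(\<Sum>T\<in>Pow A. a ^ card T) = (1 + a) ^ card A"
  using prod_add[OF assms, of "\<lambda>_. a" "\<lambda>_. 1"] by (simp add: add.commute)

text \<open>Complements in \<open>F\<close> turn the interval into the power set of
  \<open>S\<close>, and the exponent into the size of the subset. For \<open>a = y - 1\<close> a
  pure power of \<open>y\<close> remains.\<close>

lemma sum_power_card_interval:
  fixes a :: "'b::comm_semiring_1"
  assumes "finite F" "S \<subseteq> F"
  shows "(\<Sum>\<sigma> | F - S \<subseteq> \<sigma> \<and> \<sigma> \<subseteq> F. a ^ (card F - card \<sigma>)) = (1 + a) ^ card S"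
proof -
  have "(\<Sum>\<sigma> | F - S \<subseteq> \<sigma> \<and> \<sigma> \<subseteq> F. a ^ (card F - card \<sigma>)) = (\<Sum>T\<in>Pow S. a ^ card T)"
  proof (rule sum.reindex_bij_witness[where i = "\<lambda>T. F - T" and j = "\<lambda>\<sigma>. F - \<sigma>"])
    fix \<sigma> assume "\<sigma> \<in> {\<sigma>. F - S \<subseteq> \<sigma> \<and> \<sigma> \<subseteq> F}"
    then show "a ^ card (F - \<sigma>) = a ^ (card F - card \<sigma>)"
      using assms finite_subset[of \<sigma> F] by (simp add: card_Diff_subset)
  qed (use assms in auto)
  also have "\<dots> = (1 + a) ^ card S"
    using assms by (intro sum_power_card_Pow) (rule finite_subset)
  finally show ?thesis .
qed

lemma card_le_face_degree:
  assumes "finite \<Delta>" "\<tau> \<in> \<Delta>" "\<sigma> \<subseteq> \<tau>"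
  shows "card \<tau> \<le> face_degree \<Delta> \<sigma>"
  unfolding face_degree_def using assms by (intro Max_ge) auto

lemma face_degree_attained:
  assumes "finite \<Delta>" "\<sigma> \<in> \<Delta>"
  obtains \<tau> where "\<tau> \<in> \<Delta>" "\<sigma> \<subseteq> \<tau>" "card \<tau> = face_degree \<Delta> \<sigma>"
proof -
  have "face_degree \<Delta> \<sigma> \<in> {card \<tau> |\<tau>. \<tau> \<in> \<Delta> \<and> \<sigma> \<subseteq> \<tau>}"
    unfolding face_degree_def using assms by (intro Max_in) auto
  then show ?thesis using that by auto
qed

lemma h_triangle_interval_partition:
  assumes fin: "finite \<Delta>" "\<And>\<sigma>. \<sigma> \<in> \<Delta> \<Longrightarrow> finite \<sigma>"
    and down: "\<And>\<sigma> \<tau>. \<sigma> \<in> \<Delta> \<Longrightarrow> \<tau> \<subseteq> \<sigma> \<Longrightarrow> \<tau> \<in> \<Delta>"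
    and S: "\<And>F. S F \<subseteq> F"
    and ex: "\<And>\<sigma>. \<sigma> \<in> \<Delta> \<Longrightarrow>
      \<exists>F. maximal_face \<Delta> F \<and> F - S F \<subseteq> \<sigma> \<and> \<sigma> \<subseteq> F \<and> card F = face_degree \<Delta> \<sigma>"
    and unique: "\<And>\<sigma> F G. \<lbrakk>maximal_face \<Delta> F; F - S F \<subseteq> \<sigma>; \<sigma> \<subseteq> F;
      maximal_face \<Delta> G; G - S G \<subseteq> \<sigma>; \<sigma> \<subseteq> G\<rbrakk> \<Longrightarrow> F = G"
    and "j \<le> i"
  shows "h_triangle \<Delta> i j = int (card {F. maximal_face \<Delta> F \<and> card F = i \<and> card (S F) = i - j})"
proof -
  define M where "M = {F. maximal_face \<Delta> F \<and> card F = i}"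
  define I where "I F = {\<sigma>. F - S F \<subseteq> \<sigma> \<and> \<sigma> \<subseteq> F}" for F
  define A where "A = {\<sigma> \<in> \<Delta>. face_degree \<Delta> \<sigma> = i}"
  define Y :: "int poly" where "Y = [:-1, 1:]"
  have M_sub: "M \<subseteq> \<Delta>" unfolding M_def maximal_face_def by auto
  then have finM: "finite M" using fin(1) finite_subset by blast
  have finA: "finite A" unfolding A_def using fin by simp
  have finI: "finite (I F)" if "F \<in> M" for F
    using that M_sub fin(2) finite_subset[of "I F" "Pow F"] unfolding I_def by auto
  have A_eq: "A = (\<Union>F\<in>M. I F)"
  proof (intro equalityI subsetI)
    fix \<sigma> assume "\<sigma> \<in> A"
    then show "\<sigma> \<in> (\<Union>F\<in>M. I F)"
      using ex[of \<sigma>] unfolding A_def M_def I_def by auto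
  next
    fix \<sigma> assume "\<sigma> \<in> (\<Union>F\<in>M. I F)"
    then obtain F where F: "maximal_face \<Delta> F" "card F = i" "F - S F \<subseteq> \<sigma>" "\<sigma> \<subseteq> F"
      unfolding M_def I_def by auto
    then have "\<sigma> \<in> \<Delta>" using down[of F \<sigma>] unfolding maximal_face_def by simp
    \<comment> \<open>\<open>ex\<close> gives the right degree only for the interval that it
      supplies; \<open>unique\<close> identifies that interval with \<open>I F\<close>, so every
      face in \<open>I F\<close> has degree \<open>i\<close>.\<close>
    from ex[OF this] obtain G where
      G: "maximal_face \<Delta> G" "G - S G \<subseteq> \<sigma>" "\<sigma> \<subseteq> G" "card G = face_degree \<Delta> \<sigma>" by blast
    have "G = F" by (rule unique) (fact G F)+
    with G(4) F(2) \<open>\<sigma> \<in> \<Delta>\<close> show "\<sigma> \<in> A" unfolding A_def by simp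
  qed
  have disj: "I F \<inter> I G = {}" if "F \<in> M" "G \<in> M" "F \<noteq> G" for F G
  proof (rule equals0I)
    fix \<sigma> assume "\<sigma> \<in> I F \<inter> I G"
    then have "F = G" using that unfolding M_def I_def by (intro unique[of F \<sigma> G]) auto
    with that show False by simp
  qed
  have card_A: "card \<sigma> \<le> i" if "\<sigma> \<in> A" for \<sigma>
    using that card_le_face_degree[OF fin(1), of \<sigma> \<sigma>] unfolding A_def by auto
  have "(\<Sum>k\<le>i. of_nat (f_triangle \<Delta> i k) * Y ^ (i - k)) =
      (\<Sum>k\<le>i. \<Sum>\<sigma> | \<sigma> \<in> A \<and> card \<sigma> = k. Y ^ (i - card \<sigma>))"
    unfolding f_triangle_def A_def by (intro sum.cong) (auto intro: arg_cong[where f = card])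
  also have "\<dots> = (\<Sum>\<sigma>\<in>A. Y ^ (i - card \<sigma>))"
    using card_A finA by (intro sum.group) auto
  also have "\<dots> = (\<Sum>F\<in>M. \<Sum>\<sigma>\<in>I F. Y ^ (i - card \<sigma>))"
    unfolding A_eq using finM finI disj by (intro sum.UNION_disjoint) simp_all
  also have "\<dots> = (\<Sum>F\<in>M. (1 + Y) ^ card (S F))"
  proof (rule sum.cong)
    fix F assume "F \<in> M"
    then show "(\<Sum>\<sigma>\<in>I F. Y ^ (i - card \<sigma>)) = (1 + Y) ^ card (S F)"
      using sum_power_card_interval[of F "S F" Y] S[of F] M_sub fin(2)
      unfolding I_def M_def by auto
  qed simp
  also have "\<dots> = (\<Sum>F\<in>M. monom 1 (card (S F)))"
    unfolding Y_def by (simp add: one_pCons monom_altdef)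
  finally have sum_eq: "(\<Sum>k\<le>i. of_nat (f_triangle \<Delta> i k) * Y ^ (i - k)) =
      (\<Sum>F\<in>M. monom 1 (card (S F)))" .
  \<comment> \<open>The coefficients of \<open>f_polynomial\<close> beyond
    \<open>max_face_size\<close> are 0 by default, so the sum over \<open>M\<close> has to be empty
    there.\<close>
  have M_empty: "M = {}" if "\<not> i \<le> max_face_size \<Delta>"
  proof -
    have "card F \<le> max_face_size \<Delta>" if "F \<in> \<Delta>" for F
      unfolding max_face_size_def using that fin(1) by (intro Max_ge) auto
    with that M_sub show ?thesis unfolding M_def by auto
  qed
  have "coeff (f_polynomial \<Delta>) i = (\<Sum>F\<in>M. monom 1 (card (S F)))"
    unfolding coeff_f_polynomial sum_eq[unfolded Y_def] using M_empty by simp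
  then have "h_triangle \<Delta> i j = (\<Sum>F\<in>M. if card (S F) = i - j then 1 else 0)"
    unfolding h_triangle_def by (simp add: coeff_sum)
  also have "\<dots> = int (card {F \<in> M. card (S F) = i - j})"
    using finM by (simp add: sum.If_cases Int_def)
  also have "{F \<in> M. card (S F) = i - j} =
      {F. maximal_face \<Delta> F \<and> card F = i \<and> card (S F) = i - j}"
    unfolding M_def by auto
  finally show ?thesis .
qed

section \<open>Chains of valley positions\<close>

text \<open>A point $(x,y)$ is reached by $(x+y)/2$ up steps and $(x-y)/2$ down steps; two distinct
  points can be valleys of one path if and only if both numbers increase strictly.\<close>

definition prec :: "int \<times> int \<Rightarrow> int \<times> int \<Rightarrow> bool" where
  "prec p q \<longleftrightarrow> fst p + snd p < fst q + snd q \<and> fst p - snd p < fst q - snd q"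

text \<open>\<open>y < x\<close> says that at least one down step precedes the position; by parity,
  \<open>x - y\<close> is then at least 2.\<close>

definition positions :: "nat \<Rightarrow> (int \<times> int) set" where
  "positions N = {(x, y). 0 \<le> y \<and> y < x \<and> x \<le> int N \<and> even (x + y)}"

text \<open>For \<open>N = 2 * n\<close> these turn out to be the faces of
  \<open>Delta_SDyck n\<close>. Odd \<open>N\<close> are allowed for an induction that removes one
  step at a time.\<close>

definition valley_chains :: "nat \<Rightarrow> (int \<times> int) set set" where
  "valley_chains N = {C. C \<subseteq> positions N \<and> (\<forall>p\<in>C. \<forall>q\<in>C. p = q \<or> prec p q \<or> prec q p)}"

definition succs :: "(int \<times> int) set \<Rightarrow> (int \<times> int) set" where
  "succs C = {(x, y) \<in> C. (x - 2, y) \<in> C \<union> {(0, 0)}}"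

lemma succs_subset: "succs C \<subseteq> C"
  unfolding succs_def by auto

lemma finite_positions: "finite (positions N)"
proof (rule finite_subset)
  show "positions N \<subseteq> {0..int N} \<times> {0..int N}" unfolding positions_def by auto
qed simp

lemma finite_chain: "C \<in> valley_chains N \<Longrightarrow> finite C"
  unfolding valley_chains_def using finite_positions finite_subset by auto

lemma finite_chains: "finite (valley_chains N)"
  by (rule finite_subset[of _ "Pow (positions N)"]) (auto simp: valley_chains_def finite_positions)

lemma valley_chains_subset: "C \<in> valley_chains N \<Longrightarrow> B \<subseteq> C \<Longrightarrow> B \<in> valley_chains N"
  unfolding valley_chains_def by blast

lemma prec_fst: "prec p q \<Longrightarrow> fst p < fst q"
  unfolding prec_def by linarith

text \<open>The origin is not a position, but it acts as a least element and replaces the missing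
  predecessor of the first valley.\<close>

lemma prec_origin: "q \<in> positions N \<Longrightarrow> prec (0, 0) q"
  unfolding prec_def positions_def by auto

lemma valley_chain_origin_comparable:
  assumes "C \<in> valley_chains N" "p \<in> insert (0, 0) C" "q \<in> insert (0, 0) C"
  shows "p = q \<or> prec p q \<or> prec q p"
proof -
  have pos: "r = (0, 0) \<or> prec (0, 0) r" if "r \<in> insert (0, 0) C" for r
  proof (cases "r = (0, 0)")
    case False
    then have "r \<in> positions N" using that assms(1) unfolding valley_chains_def by auto
    then show ?thesis using prec_origin by simp
  qed simp
  consider "p = (0, 0)" | "q = (0, 0)" | "p \<in> C" "q \<in> C" using assms by auto
  then show ?thesis
  proof cases
    case 3
    then show ?thesis using assms(1) unfolding valley_chains_def by simp
  qed (use pos[OF assms(2)] pos[OF assms(3)] in auto)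
qed

text \<open>All coordinate sums and differences are even here, so a strict increase is one of at
  least 2. Hence \<open>(x + 2, y)\<close> is the lowest position above \<open>(x, y)\<close>;
  adding the two inequalities places it weakly left of \<open>q\<close>.\<close>

lemma prec_succ:
  assumes "prec (x, y) q" "(x, y) \<in> insert (0, 0) (positions N)" "q \<in> positions N"
  shows "(x + 2, y) \<in> positions N"
    and "x + 2 + y \<le> fst q + snd q" "x + 2 - y \<le> fst q - snd q"
proof -
  obtain a b where q: "q = (a, b)" by force
  have ev: "even (x + y)" "even (a + b)" "0 \<le> y" "y \<le> x" "a \<le> int N"
    using assms unfolding q positions_def by auto
  obtain k l where kl: "x + y = 2 * k" "a + b = 2 * l"
    using ev by (metis evenE)
  have "2 * k < 2 * l" "2 * k - 2 * y < 2 * l - 2 * b"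
    using assms(1) kl unfolding q prec_def by auto
  then have 1: "k + 1 \<le> l" "k - y + 1 \<le> l - b" by auto
  then show "x + 2 + y \<le> fst q + snd q" "x + 2 - y \<le> fst q - snd q"
    using kl unfolding q by auto
  then have "x + 2 \<le> int N" using ev unfolding q by simp
  then show "(x + 2, y) \<in> positions N"
    using ev unfolding positions_def by auto
qed

section \<open>Existence and uniqueness of the interval containing a face\<close>

lemma ex_maximal_chain:
  assumes "\<sigma> \<in> valley_chains N"
  shows "\<exists>F. maximal_face (valley_chains N) F \<and> F - succs F \<subseteq> \<sigma> \<and> \<sigma> \<subseteq> F
    \<and> card F = face_degree (valley_chains N) \<sigma>"
proof -
  define T where "T = {\<tau> \<in> valley_chains N. \<sigma> \<subseteq> \<tau> \<and> card \<tau> = face_degree (valley_chains N) \<sigma>}"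
  \<comment> \<open>The sum of the first coordinates measures how far to the right a face
    lies.\<close>
  define W where "W \<tau> = (\<Sum>p\<in>\<tau>. fst p)" for \<tau> :: "(int \<times> int) set"
  have finT: "finite T" unfolding T_def using finite_chains by simp
  have "T \<noteq> {}"
    using face_degree_attained[OF finite_chains assms] unfolding T_def by blast
  then have "Min (W ` T) \<in> W ` T" using finT by simp
  then obtain \<tau> where \<tau>: "\<tau> \<in> T" "W \<tau> = Min (W ` T)" by auto
  have W_min: "W \<tau> \<le> W \<rho>" if "\<rho> \<in> T" for \<rho>
    using that finT \<tau>(2) by simp
  have \<tau>_chain: "\<tau> \<in> valley_chains N" and \<sigma>\<tau>: "\<sigma> \<subseteq> \<tau>" and card_\<tau>: "card \<tau> = face_degree (valley_chains N) \<sigma>"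
    using \<tau>(1) unfolding T_def by auto
  have \<tau>_pos: "\<tau> \<subseteq> positions N" using \<tau>_chain unfolding valley_chains_def by auto
  have fin\<tau>: "finite \<tau>" using \<tau>_chain by (rule finite_chain)
  have "maximal_face (valley_chains N) \<tau>"
    unfolding maximal_face_def
  proof (intro conjI ballI impI)
    fix \<rho> assume \<rho>: "\<rho> \<in> valley_chains N" "\<tau> \<subseteq> \<rho>"
    then have "card \<rho> \<le> card \<tau>"
      using card_le_face_degree[OF finite_chains \<rho>(1), of \<sigma>] \<sigma>\<tau> card_\<tau> by auto
    then show "\<rho> = \<tau>" using card_seteq[OF finite_chain[OF \<rho>(1)] \<rho>(2)] by simp
  qed (rule \<tau>_chain)
  moreover have "q \<in> succs \<tau>" if q: "q \<in> \<tau>" "q \<notin> \<sigma>" for q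
  proof (rule ccontr)
    assume not_succ: "q \<notin> succs \<tau>"
    have q_pos: "q \<in> positions N" using q \<tau>_pos by auto
    \<comment> \<open>The rightmost element \<open>(x, y)\<close> of \<open>B\<close> is the
      immediate predecessor of \<open>q\<close> in the chain, or the origin. The lowest position
      above it will replace \<open>q\<close>.\<close>
    define B where "B = {p \<in> insert (0, 0) \<tau>. prec p q}"
    have "finite B" "B \<noteq> {}"
      unfolding B_def using fin\<tau> prec_origin[OF q_pos] by auto
    then have "Max (fst ` B) \<in> fst ` B" by simp
    then obtain x y where p: "(x, y) \<in> B" "x = Max (fst ` B)" by auto
    have B_max: "fst r \<le> x" if "r \<in> B" for r
      using that \<open>finite B\<close> p(2) by simp
    have p': "(x, y) \<in> insert (0, 0) \<tau>" "prec (x, y) q" using p(1) unfolding B_def by auto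
    define q' where "q' = (x + 2, y)"
    have q'_pos: "q' \<in> positions N" and le: "x + 2 + y \<le> fst q + snd q" "x + 2 - y \<le> fst q - snd q"
      unfolding q'_def using prec_succ[OF p'(2) _ q_pos] p'(1) \<tau>_pos by auto
    have "q \<noteq> q'" using not_succ q p'(1) unfolding q'_def succs_def by auto
    then have less: "fst q' < fst q" using le unfolding q'_def by (cases q) auto
    \<comment> \<open>Elements below \<open>q\<close> are weakly below \<open>(x, y)\<close>, hence
      below \<open>q'\<close>; elements above \<open>q\<close> are above \<open>q'\<close> because
      \<open>q'\<close> is weakly below \<open>q\<close>.\<close>
    have comparable: "prec r q' \<or> prec q' r" if r: "r \<in> \<tau>" "r \<noteq> q" for r
    proof -
      from r q \<tau>_chain consider "prec r q" | "prec q r" unfolding valley_chains_def by blast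
      then show ?thesis
      proof cases
        case 1
        then have "fst r \<le> x" using B_max r unfolding B_def by simp
        moreover have "prec (0, 0) r" using r \<tau>_pos prec_origin by blast
        ultimately have "(x, y) \<noteq> (0, 0)" using prec_fst by fastforce
        then have "r = (x, y) \<or> prec r (x, y) \<or> prec (x, y) r"
          using p' r \<tau>_chain unfolding valley_chains_def by blast
        then have "r = (x, y) \<or> prec r (x, y)"
          using \<open>fst r \<le> x\<close> prec_fst[of "(x, y)" r] by auto
        then show ?thesis unfolding q'_def prec_def by auto
      next
        case 2
        then show ?thesis using le unfolding q'_def prec_def by auto
      qed
    qed
    have "q' \<notin> \<tau>" using comparable[of q'] \<open>q \<noteq> q'\<close> prec_fst[of q' q'] by auto
    \<comment> \<open>The exchange keeps the size and the inclusion of \<open>\<sigma>\<close> but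
      lowers the weight, against the choice of \<open>\<tau>\<close>.\<close>
    define \<tau>' where "\<tau>' = insert q' (\<tau> - {q})"
    have "\<tau>' \<in> valley_chains N"
      using comparable \<tau>_chain q'_pos unfolding \<tau>'_def valley_chains_def by blast
    moreover have "\<sigma> \<subseteq> \<tau>'" using \<sigma>\<tau> q unfolding \<tau>'_def by auto
    moreover have "card \<tau>' = card \<tau>"
      unfolding \<tau>'_def using \<open>q' \<notin> \<tau>\<close> q fin\<tau> card.remove[OF fin\<tau> q(1)]
    by (simp del: card_Diff_singleton card_Diff_insert)
    ultimately have "W \<tau> \<le> W \<tau>'"
      using W_min card_\<tau> unfolding T_def by simp
    moreover have "W \<tau>' = W \<tau> - fst q + fst q'"
      unfolding \<tau>'_def W_def using \<open>q' \<notin> \<tau>\<close> q fin\<tau> by (simp add: sum_diff1)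
    ultimately show False using less by simp
  qed
  ultimately show ?thesis using \<sigma>\<tau> card_\<tau> by blast
qed

text \<open>Applied in both directions, this gives uniqueness of the interval. The leftmost
  \<open>q\<close> in \<open>F - G\<close> lies outside \<open>\<sigma>\<close>, hence in
  \<open>succs F\<close>, and the point two units to its left is the origin or in \<open>G\<close>.
  Then \<open>q\<close> could be added to \<open>G\<close>, against maximality.\<close>

lemma maximal_chain_subset:
  assumes F: "F \<in> valley_chains N" "F - succs F \<subseteq> \<sigma>" "\<sigma> \<subseteq> F"
    and G: "maximal_face (valley_chains N) G" "G - succs G \<subseteq> \<sigma>" "\<sigma> \<subseteq> G"
  shows "F \<subseteq> G"
proof (rule ccontr)
  assume "\<not> F \<subseteq> G"
  then have ne: "fst ` (F - G) \<noteq> {}" "finite (F - G)" using finite_chain[OF F(1)] by auto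
  then have "Min (fst ` (F - G)) \<in> fst ` (F - G)" by (intro Min_in) auto
  then obtain x y where q: "(x, y) \<in> F - G" "x = Min (fst ` (F - G))" by auto
  have min: "x \<le> fst r" if "r \<in> F - G" for r
    using that ne q(2) by simp
  have "(x, y) \<in> succs F" using q F(2) G(3) by auto
  then have "(x - 2, y) \<in> insert (0, 0) F" unfolding succs_def by auto
  then have p: "(x - 2, y) \<in> insert (0, 0) G" using min[of "(x - 2, y)"] by auto
  have G_chain: "G \<in> valley_chains N" using G(1) unfolding maximal_face_def by auto
  have G_pos: "G \<subseteq> positions N" using G_chain unfolding valley_chains_def by auto
  have cmp0: "g = (x - 2, y) \<or> prec (x - 2, y) g \<or> prec g (x - 2, y)"
    if "g \<in> insert (0, 0) G" for g
    using valley_chain_origin_comparable[OF G_chain that p] by blast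
  have comparable: "prec g (x, y) \<or> prec (x, y) g" if g: "g \<in> G" for g
  proof (rule ccontr)
    assume nc: "\<not> (prec g (x, y) \<or> prec (x, y) g)"
    obtain a b where ab: "g = (a, b)" by force
    have "g \<noteq> (x, y)" using q g by auto
    then have "g \<notin> F" using nc q F(1) unfolding valley_chains_def by blast
    then have "g \<in> succs G" using F(3) G(2) g by auto
    then have g': "(a - 2, b) \<in> insert (0, 0) G" unfolding succs_def ab by auto
    \<comment> \<open>\<open>prec\<close> is invariant under translation: \<open>(a - 2, b)\<close>
      and \<open>(x - 2, y)\<close> are equal or comparable, hence so are \<open>g\<close> and
      \<open>(x, y)\<close>.\<close>
    show False
      using cmp0[OF g'] cmp0[of g] g nc \<open>g \<noteq> (x, y)\<close> unfolding ab prec_def by auto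
  qed
  have "insert (x, y) G \<in> valley_chains N"
    using comparable G_chain q F(1) unfolding valley_chains_def by blast
  then have "insert (x, y) G = G" using G(1) unfolding maximal_face_def by blast
  then show False using q by auto
qed

lemma h_triangle_chains:
  assumes "j \<le> i"
  shows "h_triangle (valley_chains N) i j =
    int (card {F. maximal_face (valley_chains N) F \<and> card F = i \<and> card (succs F) = i - j})"
proof (rule h_triangle_interval_partition)
  fix \<sigma> F G
  assume "maximal_face (valley_chains N) F" "F - succs F \<subseteq> \<sigma>" "\<sigma> \<subseteq> F"
    "maximal_face (valley_chains N) G" "G - succs G \<subseteq> \<sigma>" "\<sigma> \<subseteq> G"
  then show "F = G"
    using maximal_chain_subset[of F N \<sigma> G] maximal_chain_subset[of G N \<sigma> F]
    unfolding maximal_face_def by blast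
next
  fix \<sigma> assume "\<sigma> \<in> valley_chains N"
  then show "\<exists>F. maximal_face (valley_chains N) F \<and> F - succs F \<subseteq> \<sigma> \<and> \<sigma> \<subseteq> F
      \<and> card F = face_degree (valley_chains N) \<sigma>"
    by (rule ex_maximal_chain)
qed (fact finite_chains, erule finite_chain, erule (1) valley_chains_subset, rule succs_subset,
  rule assms)

section \<open>First halves of symmetric paths\<close>

text \<open>A final down step counts as a valley, since in the symmetric path it is followed by an
  up step.\<close>

definition half_valleys :: "step list \<Rightarrow> (int \<times> int) set" where
  "half_valleys u = (\<lambda>i. (int i, height u i)) `
     {i. 1 \<le> i \<and> i \<le> length u \<and> u ! (i - 1) = D \<and> (i < length u \<longrightarrow> u ! i = U)}"

definition nonneg :: "step list \<Rightarrow> bool" where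
  "nonneg u \<longleftrightarrow> (\<forall>i\<le>length u. height u i \<ge> 0)"

lemma height_append: "i \<le> length u \<Longrightarrow> height (u @ v) i = height u i"
  unfolding height_def by simp

lemma height_snoc_length:
  "height (u @ [s]) (Suc (length u)) = height u (length u) + (if s = U then 1 else -1)"
  unfolding height_def by (cases s) auto

lemma nonneg_snoc:
  "nonneg (u @ [s]) \<longleftrightarrow> nonneg u \<and> height u (length u) + (if s = U then 1 else -1) \<ge> 0"
  unfolding nonneg_def using height_snoc_length[of u s]
  by (auto simp: le_Suc_eq height_append)

lemma half_valleys_Nil [simp]: "half_valleys [] = {}"
  unfolding half_valleys_def by auto

text \<open>A final down step of \<open>u\<close> already counts as a valley, so an up step after it
  changes nothing.\<close>

lemma half_valleys_snoc_U [simp]: "half_valleys (u @ [U]) = half_valleys u"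
proof -
  have "1 \<le> i \<and> i \<le> length (u @ [U]) \<and> (u @ [U]) ! (i - 1) = D
      \<and> (i < length (u @ [U]) \<longrightarrow> (u @ [U]) ! i = U) \<longleftrightarrow>
    1 \<le> i \<and> i \<le> length u \<and> u ! (i - 1) = D \<and> (i < length u \<longrightarrow> u ! i = U)" for i
    by (cases "i < length u"; cases "i = length u") (auto simp: nth_append le_Suc_eq)
  then show ?thesis
    unfolding half_valleys_def by (intro image_cong) (auto simp: height_append)
qed

text \<open>The old end point, if it counted as a valley, is now followed by a down step and drops
  out.\<close>

lemma half_valleys_snoc_D [simp]:
  "half_valleys (u @ [D]) = insert (int (Suc (length u)), height u (length u) - 1)
    {p \<in> half_valleys u. fst p < int (length u)}"
proof -
  define I where "I = {i. 1 \<le> i \<and> i < length u \<and> u ! (i - 1) = D \<and> u ! i = U}"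
  have "1 \<le> i \<and> i \<le> length (u @ [D]) \<and> (u @ [D]) ! (i - 1) = D
      \<and> (i < length (u @ [D]) \<longrightarrow> (u @ [D]) ! i = U) \<longleftrightarrow>
    i = Suc (length u) \<or> i \<in> I" for i
    unfolding I_def
    by (cases "i < length u"; cases "i = length u") (auto simp: nth_append le_Suc_eq)
  then have "half_valleys (u @ [D]) =
      (\<lambda>i. (int i, height (u @ [D]) i)) ` insert (Suc (length u)) I"
    unfolding half_valleys_def by (intro image_cong) auto
  also have "\<dots> = insert (int (Suc (length u)), height u (length u) - 1)
      ((\<lambda>i. (int i, height (u @ [D]) i)) ` I)"
    using height_snoc_length[of u D] by simp
  also have "(\<lambda>i. (int i, height (u @ [D]) i)) ` I = (\<lambda>i. (int i, height u i)) ` I"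
    by (intro image_cong) (auto simp: height_append I_def)
  also have "\<dots> = {p \<in> half_valleys u. fst p < int (length u)}"
    unfolding half_valleys_def I_def by auto
  finally show ?thesis .
qed

section \<open>Valleys and the end height of a half path\<close>

lemma height_length_bounds:
  "height u (length u) \<le> int (length u)" "even (height u (length u) + int (length u))"
proof (induction u rule: rev_induct)
  case (snoc s u)
  { case 1 then show ?case using snoc height_snoc_length[of u s] by auto }
  { case 2 then show ?case using snoc height_snoc_length[of u s] by auto }
qed (auto simp: height_def)

text \<open>\<open>x - y\<close> and \<open>x + y\<close> are twice the numbers of down and up steps
  before the valley, hence at most their values at the end of \<open>u\<close>. An up step follows
  each inner valley, which makes one bound strict; a down step precedes each valley, so
  \<open>x - y\<close> is at least 2.\<close>

lemma half_valleys_bounds: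
  assumes "(x, y) \<in> half_valleys u"
  shows "x \<le> int (length u)" "x - y \<le> int (length u) - height u (length u)"
    "x + y \<le> int (length u) + height u (length u)"
    "x < int (length u) \<Longrightarrow> x + y < int (length u) + height u (length u)"
    "x = int (length u) \<Longrightarrow> y = height u (length u)"
    "2 \<le> x - y" "even (x + y)"
proof -
  have "x \<le> int (length u) \<and> x - y \<le> int (length u) - height u (length u) \<and>
    x + y \<le> int (length u) + height u (length u) \<and>
    (x < int (length u) \<longrightarrow> x + y < int (length u) + height u (length u)) \<and>
    (x = int (length u) \<longrightarrow> y = height u (length u)) \<and> 2 \<le> x - y \<and> even (x + y)"
    using assms
  proof (induction u rule: rev_induct)
    case (snoc s u)
    show ?case
    proof (cases s)
      case U
      then show ?thesis using snoc height_snoc_length[of u s] by auto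
    next
      case D
      then show ?thesis
        using snoc height_snoc_length[of u s] height_length_bounds[of u]
        by auto
    qed
  qed simp
  then show "x \<le> int (length u)" "x - y \<le> int (length u) - height u (length u)"
    "x + y \<le> int (length u) + height u (length u)"
    "x < int (length u) \<Longrightarrow> x + y < int (length u) + height u (length u)"
    "x = int (length u) \<Longrightarrow> y = height u (length u)"
    "2 \<le> x - y" "even (x + y)"
    by auto
qed

text \<open>Only up steps follow the last valley, or the origin if there is none, so
  \<open>x - y\<close> stays constant from there on. With the bounds above, the valleys thus
  determine the end height.\<close>

lemma last_half_valley:
  obtains x y where "(x, y) \<in> insert (0, 0) (half_valleys u)"
    "x - y = int (length u) - height u (length u)"
proof -
  have "\<exists>(x, y)\<in>insert (0, 0) (half_valleys u). x - y = int (length u) - height u (length u)"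
  proof (induction u rule: rev_induct)
    case (snoc s u)
    then show ?case using height_snoc_length[of u s] by (cases s) auto
  qed (simp add: height_def)
  then show ?thesis using that by blast
qed

lemma half_valleys_chain:
  assumes "nonneg u"
  shows "half_valleys u \<in> valley_chains (length u)"
proof -
  have "half_valleys u \<subseteq> positions (length u)"
  proof safe
    fix x y assume xy: "(x, y) \<in> half_valleys u"
    then have "0 \<le> y" using assms unfolding half_valleys_def nonneg_def by auto
    then show "(x, y) \<in> positions (length u)"
      using half_valleys_bounds[OF xy] unfolding positions_def by auto
  qed
  moreover have "\<forall>p\<in>half_valleys u. \<forall>q\<in>half_valleys u. p = q \<or> prec p q \<or> prec q p"
  proof (induction u rule: rev_induct)
    case (snoc s u)
    show ?case
    proof (cases s)
      case U
      then show ?thesis using snoc by simp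
    next
      case D
      have "prec p (int (Suc (length u)), height u (length u) - 1)"
        if "p \<in> half_valleys u" "fst p < int (length u)" for p
        using half_valleys_bounds[of "fst p" "snd p" u] that unfolding prec_def by auto
      then show ?thesis using snoc D by auto
    qed
  qed simp
  ultimately show ?thesis unfolding valley_chains_def by simp
qed

section \<open>Half paths are determined by their valleys, and every chain occurs\<close>

text \<open>Induction on the last step, which is taken to be \<open>D\<close> if \<open>C\<close>
  has a point in the last column and \<open>U\<close> otherwise. For \<open>D\<close>, a half path
  of length \<open>N\<close> is needed that ends at height \<open>y + 1\<close> and has inner
  valleys \<open>C'\<close>; the two subcases differ in whether its end point counts as a
  valley.\<close>

lemma chain_is_half_valleys:
  "C \<in> valley_chains N \<Longrightarrow> \<exists>u. length u = N \<and> nonneg u \<and> half_valleys u = C"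
proof (induction N arbitrary: C)
  case 0
  then have "C = {}" unfolding valley_chains_def positions_def by auto
  then show ?case by (auto simp: nonneg_def height_def)
next
  case (Suc N)
  show ?case
  proof (cases "\<exists>y. (int (Suc N), y) \<in> C")
    case False
    have "C \<subseteq> positions N"
    proof safe
      fix x y assume xy: "(x, y) \<in> C"
      then have "(x, y) \<in> positions (Suc N)" using Suc.prems unfolding valley_chains_def by auto
      moreover have "x \<noteq> int (Suc N)" using xy False by auto
      ultimately show "(x, y) \<in> positions N" unfolding positions_def by auto
    qed
    then have "C \<in> valley_chains N" using Suc.prems unfolding valley_chains_def by auto
    with Suc.IH obtain u where u: "length u = N" "nonneg u" "half_valleys u = C" by blast
    then have "nonneg (u @ [U])" unfolding nonneg_snoc by (auto simp: nonneg_def)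
    with u show ?thesis by (intro exI[of _ "u @ [U]"]) simp
  next
    case True
    then obtain y where y: "(int (Suc N), y) \<in> C" by auto
    define C' where "C' = C - {(int (Suc N), y)}"
    have y_pos: "0 \<le> y" "y \<le> int N" "even (int N + 1 + y)"
      using Suc.prems y unfolding valley_chains_def positions_def by auto
    have C'_pos: "C' \<subseteq> positions (Suc N)"
      using Suc.prems unfolding C'_def valley_chains_def by auto
    \<comment> \<open>By parity both strict inequalities are gaps of 2; adding them puts the
      remaining points left of column \<open>N\<close>.\<close>
    have bound: "a + b < int N + 1 + y" "a - b \<le> int N - y - 1" "a < int N" "0 \<le> b"
      "even (a + b)" if ab: "(a, b) \<in> C'" for a b
    proof -
      have pos: "0 \<le> b" "a \<le> int (Suc N)" "even (a + b)"
        using ab C'_pos unfolding positions_def by auto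
      have "prec (a, b) (int (Suc N), y) \<or> prec (int (Suc N), y) (a, b)"
        using Suc.prems y ab unfolding valley_chains_def C'_def by blast
      then have prec: "a + b < int N + 1 + y" "a - b < int N + 1 - y"
        using pos unfolding prec_def by auto
      obtain k l where kl: "a + b = 2 * k" "int N + 1 + y = 2 * l"
        using pos y_pos by (metis evenE)
      show "a - b \<le> int N - y - 1" "a < int N"
        using prec kl by presburger+
      show "a + b < int N + 1 + y" "0 \<le> b" "even (a + b)"
        using prec pos by auto
    qed
    have C'_pos': "C' \<subseteq> positions N"
      using C'_pos bound(3) unfolding positions_def by force
    have inner: "{p \<in> C'. fst p < int N} = C'" using bound(3) by force
    have C: "C = insert (int (Suc N), y) C'" using y unfolding C'_def by auto
    have C'_chain: "C' \<in> valley_chains N"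
      using Suc.prems C'_pos' unfolding C'_def valley_chains_def by blast
    show ?thesis
    proof (cases "\<exists>(a, b)\<in>insert (0, 0) C'. a - b = int N - y - 1")
      \<comment> \<open>Some point of \<open>C'\<close>, or the origin, has all down steps but the
        last one behind it. Only up steps are left before column \<open>N\<close>, so the path from
        the induction hypothesis ends at height \<open>y + 1\<close>.\<close>
      case True
      obtain u where u: "length u = N" "nonneg u" "half_valleys u = C'"
        using Suc.IH[OF C'_chain] by blast
      obtain a b where ab: "(a, b) \<in> insert (0, 0) C'" "a - b = int N - height u N"
        using last_half_valley[of u, unfolded u] by blast
      \<comment> \<open>If the last valley is replaced by the origin, the bound is only
        \<open>y\<close> in place of \<open>y + 1\<close>; parity closes the gap.\<close>
      have "height u N \<noteq> y" using height_length_bounds(2)[of u] u y_pos(3) by auto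
      then have "y + 1 \<le> height u N"
        using ab bound(2)[of a b] y_pos by auto
      moreover have "height u N \<le> y + 1"
      proof -
        obtain c d where cd: "(c, d) \<in> insert (0, 0) C'" "c - d = int N - y - 1"
          using True by blast
        then show ?thesis
          using half_valleys_bounds(2)[of c d u] height_length_bounds(1)[of u] u by auto
      qed
      ultimately have h: "height u N = y + 1" by simp
      have "nonneg (u @ [D])" using u(1,2) h y_pos unfolding nonneg_snoc by simp
      moreover have "half_valleys (u @ [D]) = C"
        unfolding half_valleys_snoc_D u(1,3) h C inner by simp
      ultimately show ?thesis using u by (intro exI[of _ "u @ [D]"]) simp
    next
      \<comment> \<open>Another down step has to precede the last one. The extra valley
        \<open>(N, y + 1)\<close> forces it, and vanishes when the last \<open>D\<close> is
        appended. It is a position because the case assumption also excludes the origin.\<close>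
      case False
      have bound': "a - b < int N - y - 1" if "(a, b) \<in> C'" for a b
      proof -
        have "a - b \<noteq> int N - y - 1" using that False by blast
        then show ?thesis using bound(2)[OF that] by linarith
      qed
      have "int N - y - 1 \<noteq> 0" using False by auto
      then have "y + 1 < int N" using y_pos by presburger
      then have "(int N, y + 1) \<in> positions N"
        using y_pos unfolding positions_def by auto
      moreover have "prec p (int N, y + 1)" if "p \<in> C'" for p
        using that bound(1)[of "fst p" "snd p"] bound'[of "fst p" "snd p"]
        unfolding prec_def by auto
      ultimately have "insert (int N, y + 1) C' \<in> valley_chains N"
        using C'_chain unfolding valley_chains_def by simp
      with Suc.IH obtain u where
        u: "length u = N" "nonneg u" "half_valleys u = insert (int N, y + 1) C'" by blast
      have "(int N, y + 1) \<in> half_valleys u" unfolding u(3) by simp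
      then have h: "height u N = y + 1" using half_valleys_bounds(5) u(1) by metis
      have "nonneg (u @ [D])" using u(1,2) h y_pos unfolding nonneg_snoc by simp
      moreover have "half_valleys (u @ [D]) = C"
      proof -
        have "{p \<in> insert (int N, y + 1) C'. fst p < int N} = {p \<in> C'. fst p < int N}"
          by auto
        then show ?thesis unfolding half_valleys_snoc_D u(1,3) h C inner by simp
      qed
      ultimately show ?thesis using u by (intro exI[of _ "u @ [D]"]) simp
    qed
  qed
qed

text \<open>The end point is dropped from the set of valleys in the induction because whether it is a
  valley is not visible after another down step.\<close>

lemma inner_half_valleys_inject:
  assumes "length u = length v" "height u (length u) = height v (length v)"
    and "{p \<in> half_valleys u. fst p < int (length u)} = {p \<in> half_valleys v. fst p < int (length v)}"
  shows "u = v"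
  using assms
proof (induction u arbitrary: v rule: rev_induct)
  case (snoc s a v)
  then obtain b t where v: "v = b @ [t]" and len: "length a = length b"
    by (cases v rule: rev_cases) auto
  have all: "{p \<in> half_valleys c. fst p < int (Suc (length c))} = half_valleys c" for c
    using half_valleys_bounds(1)[of _ _ c] by force
  \<comment> \<open>If the last letters differ, \<open>c\<close> (before \<open>U\<close>) ends 2
    below \<open>d\<close> (before \<open>D\<close>). The last valley of \<open>c\<close>, or the
    origin, would then have more down steps before it than \<open>d\<close> has in total.\<close>
  have UD: False
    if heq: "height c (length c) + 2 = height d (length d)" and l: "length c = length d"
      and val: "half_valleys c = {p \<in> half_valleys d. fst p < int (length d)}" for c d
  proof -
    obtain x y where xy: "(x, y) \<in> insert (0, 0) (half_valleys c)"
      "x - y = int (length c) - height c (length c)"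
      by (rule last_half_valley)
    then have "(x, y) = (0, 0) \<or> (x, y) \<in> half_valleys d" using val by auto
    then show False
      using xy(2) heq l half_valleys_bounds(2)[of x y d] height_length_bounds(1)[of d] by auto
  qed
  have D: "{p \<in> half_valleys (c @ [D]). fst p < int (Suc (length c))} =
      {p \<in> half_valleys c. fst p < int (length c)}" for c
    by auto
  have hs: "height a (length a) + (if s = U then 1 else -1) =
      height b (length b) + (if t = U then 1 else -1)"
    using snoc.prems(2) unfolding v by (simp add: height_snoc_length)
  have vals: "{p \<in> half_valleys (a @ [s]). fst p < int (Suc (length a))} =
      {p \<in> half_valleys (b @ [t]). fst p < int (Suc (length b))}"
    using snoc.prems(3) unfolding v by simp
  show ?case
  proof (cases s; cases t)
    assume st: "s = U" "t = U"
    then have "half_valleys a = half_valleys b" using vals by (simp add: all del: of_nat_Suc)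
    then show ?thesis using snoc.IH[of b] len hs st v by simp
  next
    assume st: "s = D" "t = D"
    then show ?thesis using snoc.IH[of b] len hs vals v unfolding st D by simp
  next
    assume st: "s = U" "t = D"
    then have "half_valleys a = {p \<in> half_valleys b. fst p < int (length b)}"
      using vals unfolding st D half_valleys_snoc_U all by simp
    moreover have "height a (length a) + 2 = height b (length b)" using hs st by simp
    ultimately have False using UD len by blast
    then show ?thesis ..
  next
    assume st: "s = D" "t = U"
    have "half_valleys b = {p \<in> half_valleys a. fst p < int (length a)}"
      using vals unfolding st D half_valleys_snoc_U all by (rule sym)
    moreover have "height b (length b) + 2 = height a (length a)" using hs st by simp
    ultimately have False using UD len[symmetric] by blast
    then show ?thesis ..
  qed
qed simp

text \<open>Length minus end height is the largest \<open>x - y\<close> among the valleys and the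
  origin, so equal valleys give equal end heights.\<close>

lemma half_valleys_inject:
  assumes "length u = length v" "half_valleys u = half_valleys v"
  shows "u = v"
proof (rule inner_half_valleys_inject)
  have le: "height c (length c) \<le> height d (length d)"
    if l: "length c = length d" and val: "half_valleys c = half_valleys d" for c d
  proof -
    obtain x y where xy: "(x, y) \<in> insert (0, 0) (half_valleys d)"
      "x - y = int (length d) - height d (length d)"
      by (rule last_half_valley)
    then have "x - y \<le> int (length c) - height c (length c)"
      using half_valleys_bounds(2)[of x y c] height_length_bounds(1)[of c] unfolding val by auto
    then show ?thesis using xy(2) l by simp
  qed
  show "height u (length u) = height v (length v)"
    using le[of u v] le[of v u] assms by simp
qed (simp_all only: assms)

section \<open>Symmetric paths and chains\<close>

definition mirror :: "step list \<Rightarrow> step list" where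
  "mirror u = u @ map bar (rev u)"

lemma count_list_map_bar_rev:
  "count_list (map bar (rev u)) U = count_list u D"
  "count_list (map bar (rev u)) D = count_list u U"
proof -
  have "count_list (map bar u) U = count_list u D \<and> count_list (map bar u) D = count_list u U"
  proof (induction u)
    case (Cons s u)
    then show ?case by (cases s) auto
  qed simp
  then show "count_list (map bar (rev u)) U = count_list u D"
    "count_list (map bar (rev u)) D = count_list u U"
    by (simp_all flip: rev_map)
qed

text \<open>The steps after the middle undo the last steps of \<open>u\<close> in reverse
  order.\<close>

lemma height_mirror:
  assumes "k \<le> length u"
  shows "height (mirror u) (length u + k) = height u (length u - k)"
proof -
  have take: "take (length u + k) (mirror u) = u @ map bar (rev (drop (length u - k) u))"
    unfolding mirror_def by (simp add: take_map take_rev)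
  have "count_list u s = count_list (take (length u - k) u) s
      + count_list (drop (length u - k) u) s" for s
    by (simp flip: count_list_append)
  then show ?thesis
    unfolding height_def take by (simp add: count_list_map_bar_rev)
qed

lemma bar_bar [simp]: "bar (bar s) = s"
  by (cases s) auto

lemma mirror_in_SDyck:
  assumes "nonneg u" "length u = m"
  shows "mirror u \<in> SDyck m"
proof -
  have len: "length (mirror u) = 2 * m" using assms unfolding mirror_def by simp
  have "height (mirror u) i \<ge> 0" if "i \<le> 2 * m" for i
  proof (cases "i \<le> m")
    case True
    then show ?thesis using assms unfolding mirror_def nonneg_def by (simp add: height_append)
  next
    case False
    then show ?thesis
      using height_mirror[of "i - m" u] assms that unfolding nonneg_def by simp
  qed
  moreover have "height (mirror u) (2 * m) = 0"
    using height_mirror[of m u] assms(2) by (simp add: height_def mult_2)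
  moreover have "mirror u ! (2 * m + 1 - i - 1) = bar (mirror u ! (i - 1))"
    if "i \<in> {1..2 * m}" for i
  proof (cases "i \<le> m")
    case True
    have "2 * m - i - m = m - i" "m - Suc (m - i) = i - 1" using True that by auto
    then show ?thesis
      using that True assms(2) unfolding mirror_def by (auto simp: nth_append rev_nth)
  next
    case False
    then show ?thesis
      using that assms(2) unfolding mirror_def by (auto simp: nth_append rev_nth mult_2)
  qed
  ultimately show ?thesis using len unfolding SDyck_def dyck_def symmetric_def by auto
qed

lemma SDyck_eq_mirror:
  assumes "w \<in> SDyck m"
  shows "w = mirror (take m w)"
proof (rule nth_equalityI)
  have len: "length w = 2 * m" using assms unfolding SDyck_def dyck_def by auto
  then show "length w = length (mirror (take m w))" unfolding mirror_def by simp
  fix k assume k: "k < length w"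
  show "w ! k = mirror (take m w) ! k"
  proof (cases "k < m")
    case True
    then show ?thesis using len unfolding mirror_def by (simp add: nth_append)
  next
    case False
    \<comment> \<open>List index \<open>k\<close> is letter \<open>k + 1\<close> in the numbering of
      \<open>symmetric\<close>, and its mirror image is letter \<open>2 * m - k\<close>.\<close>
    have "2 * m - k \<in> {1..length w}" using k len by auto
    then have "w ! (length w + 1 - (2 * m - k) - 1) = bar (w ! (2 * m - k - 1))"
      using assms unfolding SDyck_def symmetric_def by blast
    moreover have "length w + 1 - (2 * m - k) - 1 = k" using k len by simp
    moreover have "m - Suc (k - m) = 2 * m - k - 1" using k len False by simp
    ultimately show ?thesis
      using k len False unfolding mirror_def by (simp add: nth_append rev_nth)
  qed
qed

lemma nonneg_take_SDyck: "w \<in> SDyck m \<Longrightarrow> nonneg (take m w)"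
  unfolding SDyck_def dyck_def nonneg_def height_def by auto

lemma length_take_SDyck: "w \<in> SDyck m \<Longrightarrow> length (take m w) = m"
  unfolding SDyck_def dyck_def by auto

text \<open>The letter after the midpoint is the \<open>bar\<close> of the last letter of
  \<open>u\<close>, so a final down step yields a genuine valley and a final up step none.\<close>

lemma V_half_mirror:
  assumes "length u = 2 * n"
  shows "V_half n (mirror u) = half_valleys u"
proof -
  have "1 \<le> i \<and> i < length (mirror u) \<and> mirror u ! (i - 1) = D \<and> mirror u ! i = U
      \<and> i \<le> 2 * n \<longleftrightarrow>
    1 \<le> i \<and> i \<le> length u \<and> u ! (i - 1) = D \<and> (i < length u \<longrightarrow> u ! i = U)" for i
    using assms unfolding mirror_def
    by (cases "i < length u"; cases "i = length u") (auto simp: nth_append rev_nth)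
  then have "{i. 1 \<le> i \<and> i < length (mirror u) \<and> mirror u ! (i - 1) = D \<and> mirror u ! i = U
      \<and> i \<le> 2 * n} =
    {i. 1 \<le> i \<and> i \<le> length u \<and> u ! (i - 1) = D \<and> (i < length u \<longrightarrow> u ! i = U)}"
    by auto
  moreover have "V_half n (mirror u) = (\<lambda>i. (int i, height (mirror u) i)) `
    {i. 1 \<le> i \<and> i < length (mirror u) \<and> mirror u ! (i - 1) = D \<and> mirror u ! i = U
      \<and> i \<le> 2 * n}"
    unfolding V_half_def valleys_def by auto
  ultimately show ?thesis
    unfolding half_valleys_def
    by (simp only:) (intro image_cong, auto simp: mirror_def height_append)
qed

lemma V_half_eq_half_valleys:
  "w \<in> SDyck (2 * n) \<Longrightarrow> V_half n w = half_valleys (take (2 * n) w)"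
  using V_half_mirror[OF length_take_SDyck] SDyck_eq_mirror by metis

lemma inj_on_V_half: "inj_on (V_half n) (SDyck (2 * n))"
proof (rule inj_onI)
  fix w w' assume w: "w \<in> SDyck (2 * n)" "w' \<in> SDyck (2 * n)" "V_half n w = V_half n w'"
  then have "take (2 * n) w = take (2 * n) w'"
    by (intro half_valleys_inject) (simp_all add: V_half_eq_half_valleys length_take_SDyck
      del: length_take)
  then show "w = w'" using SDyck_eq_mirror w by metis
qed

lemma Delta_SDyck_eq_valley_chains: "Delta_SDyck n = valley_chains (2 * n)"
proof (intro equalityI subsetI)
  fix C assume "C \<in> Delta_SDyck n"
  then obtain w where "w \<in> SDyck (2 * n)" "C = V_half n w"
    unfolding Delta_SDyck_def by auto
  then show "C \<in> valley_chains (2 * n)"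
    using half_valleys_chain[OF nonneg_take_SDyck] V_half_eq_half_valleys length_take_SDyck
    by metis
next
  fix C assume "C \<in> valley_chains (2 * n)"
  then obtain u where "length u = 2 * n" "nonneg u" "half_valleys u = C"
    using chain_is_half_valleys by blast
  then show "C \<in> Delta_SDyck n"
    using mirror_in_SDyck V_half_mirror unfolding Delta_SDyck_def by blast
qed

theorem theorem4p5:
  fixes n i j :: nat
  assumes "n \<ge> 1" and "j \<le> i" and "i \<le> n"
  shows "h_triangle (Delta_SDyck n) i j =
    int (card {w \<in> SDyck_max n. card (V_half n w) = i \<and> suc_B n w = i - j})"
proof -
  define A where "A = {w \<in> SDyck_max n. card (V_half n w) = i \<and> suc_B n w = i - j}"
  have "suc_B n w = card (succs (V_half n w))" for w
    unfolding suc_B_def succs_def ..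
  \<comment> \<open>Every face comes from a path by definition; injectivity then turns the count of
    maximal faces into a count of paths.\<close>
  then have "V_half n ` A =
      {F. maximal_face (Delta_SDyck n) F \<and> card F = i \<and> card (succs F) = i - j}"
    unfolding A_def SDyck_max_def maximal_face_def Delta_SDyck_def by auto
  moreover have "A \<subseteq> SDyck (2 * n)" unfolding A_def SDyck_max_def by auto
  then have "card (V_half n ` A) = card A"
    by (intro card_image inj_on_subset[OF inj_on_V_half])
  ultimately show ?thesis
    using h_triangle_chains[OF assms(2), of "2 * n"]
    unfolding A_def Delta_SDyck_eq_valley_chains by simp
qed

end
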